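(* Every disk graph $G$ contains an $11$-simplicial vertex. Consequently, every disk graph $G$ satisfies $h(G)\le 11\omega(G)+1$.
   Context: A disk graph is the intersection graph of a finite family of disks in the plane. For a positive integer $\gamma$, a vertex $v$ of $G$ is $\gamma$-simplicial if its neighborhood $N_G(v)$ is a union of at most $\gamma$ cliques (a disjoint union of at most $\gamma$ cliques as vertex sets). $\omega(G)$ is the clique number. A hitting set of $G$ is a set $T\subseteq V(G)$ meeting every maximum independent set of $G$; $h(G)$ is the minimum size of a hitting set. *)

theory Defs
  imports "HOL-Analysis.Analysis" "HOL-Library.Ramsey"
begin

text \<open>
  A finite simple graph is given by a vertex set \<open>V\<close> and a set \<open>E\<close> of two-element subsets of \<open>V\<close>;
  \<^const>\<open>clique\<close> and \<^const>\<open>indep\<close> are the notions of \<^theory>\<open>HOL-Library.Ramsey\<close>.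
\<close>

text \<open>
  The disks are indexed by the vertices, so a disk may occur several times in the family. Disks are
  closed and of positive radius; tangent disks intersect.
\<close>

definition disk_graph :: "'a set \<Rightarrow> 'a set set \<Rightarrow> bool" where
  "disk_graph V E \<longleftrightarrow> finite V \<and>
     (\<exists>(c :: 'a \<Rightarrow> real ^ 2) (r :: 'a \<Rightarrow> real). (\<forall>v\<in>V. r v > 0) \<and>
        E = {{u, v} |u v. u \<in> V \<and> v \<in> V \<and> u \<noteq> v \<and>
                          cball (c u) (r u) \<inter> cball (c v) (r v) \<noteq> {}})"

definition neighborhood :: "'a set \<Rightarrow> 'a set set \<Rightarrow> 'a \<Rightarrow> 'a set" where
  "neighborhood V E v = {u \<in> V. {u, v} \<in> E}"

definition simplicial :: "nat \<Rightarrow> 'a set \<Rightarrow> 'a set set \<Rightarrow> 'a \<Rightarrow> bool" where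
  "simplicial \<gamma> V E v \<longleftrightarrow> v \<in> V \<and>
     (\<exists>\<C>. finite \<C> \<and> card \<C> \<le> \<gamma> \<and> (\<forall>K\<in>\<C>. clique K E) \<and> pairwise disjnt \<C> \<and>
          neighborhood V E v = \<Union>\<C>)"

definition clique_number :: "'a set \<Rightarrow> 'a set set \<Rightarrow> nat" where
  "clique_number V E = Max {card K |K. K \<subseteq> V \<and> clique K E}"

definition max_indep :: "'a set \<Rightarrow> 'a set set \<Rightarrow> 'a set \<Rightarrow> bool" where
  "max_indep V E I \<longleftrightarrow> I \<subseteq> V \<and> indep I E \<and> (\<forall>J. J \<subseteq> V \<and> indep J E \<longrightarrow> card J \<le> card I)"

definition hitting_set :: "'a set \<Rightarrow> 'a set set \<Rightarrow> 'a set \<Rightarrow> bool" where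
  "hitting_set V E T \<longleftrightarrow> T \<subseteq> V \<and> (\<forall>I. max_indep V E I \<longrightarrow> T \<inter> I \<noteq> {})"

text \<open>
  The graph without vertices has no hitting set, because its only maximum independent set is empty;
  the following minimum is meaningful for \<open>V \<noteq> {}\<close>, when \<open>V\<close> itself is a hitting set.
\<close>

definition hitting_number :: "'a set \<Rightarrow> 'a set set \<Rightarrow> nat" where
  "hitting_number V E = Min {card T |T. hitting_set V E T}"

end

theory Submission
  imports Defs
begin

text \<open>
  Let \<open>v\<close> be a vertex whose disk has the smallest radius \<open>\<rho>\<close>. Every disk that meets the disk of \<open>v\<close>
  contains a disk of radius \<open>\<rho>\<close> whose centre has distance at most \<open>2\<rho>\<close> from the centre of \<open>v\<close>. The
  ball of radius \<open>2\<rho>\<close> lies in a 3 by 3 array of squares with diagonal \<open>2\<rho>\<close>, so the nine centres of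
  these squares pierce all disks that meet the disk of \<open>v\<close>. Disks through a common point form a clique, hence
  \<open>v\<close> is even 9-simplicial. Finally, the closed neighborhood of any vertex meets every maximal
  independent set, and for a \<open>\<gamma>\<close>-simplicial vertex it has at most \<open>\<gamma> \<omega>(G) + 1\<close> elements.
\<close>

text \<open>The fibres of \<open>f\<close> over the points of \<open>P\<close> serve as the cliques:
  they are indexed by \<open>P\<close>, so there are at most \<gamma> of them, and distinct fibres
  are disjoint. Empty fibres do no harm.\<close>

lemma simplicialI_map:
  assumes "v \<in> V" "finite P" "card P \<le> \<gamma>"
    and f: "f ` neighborhood V E v \<subseteq> P"
    and same: "\<And>u w. u \<in> neighborhood V E v \<Longrightarrow> w \<in> neighborhood V E v \<Longrightarrow>
                f u = f w \<Longrightarrow> u \<noteq> w \<Longrightarrow> {u, w} \<in> E"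
  shows "simplicial \<gamma> V E v"
proof -
  let ?N = "neighborhood V E v"
  define C where "C = (\<lambda>p. {u \<in> ?N. f u = p}) ` P"
  have "finite C" "card C \<le> \<gamma>"
    using assms(2,3) card_image_le[OF assms(2)] unfolding C_def by (auto intro: order_trans)
  moreover have "\<forall>K\<in>C. clique K E"
    using same unfolding C_def clique_def by auto
  moreover have "pairwise disjnt C"
    unfolding C_def pairwise_def disjnt_def by auto
  moreover have "?N = \<Union>C"
    using f unfolding C_def by auto
  ultimately show ?thesis
    using assms(1) unfolding simplicial_def by blast
qed

lemma simplicial_mono:
  assumes "simplicial \<gamma> V E v" "\<gamma> \<le> \<delta>"
  shows "simplicial \<delta> V E v"
  using assms unfolding simplicial_def by (meson order_trans)

lemma card_clique_le_clique_number:
  assumes "finite V" "K \<subseteq> V" "clique K E"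
  shows "card K \<le> clique_number V E"
proof -
  have "{card K |K. K \<subseteq> V \<and> clique K E} \<subseteq> card ` Pow V" by auto
  then have "finite {card K |K. K \<subseteq> V \<and> clique K E}"
    using assms(1) by (meson finite_Pow_iff finite_imageI finite_subset)
  then show ?thesis
    unfolding clique_number_def using assms(2,3) by (intro Max_ge) auto
qed

lemma hitting_number_le_card:
  assumes "finite V" "hitting_set V E T"
  shows "hitting_number V E \<le> card T"
proof -
  have "{card T |T. hitting_set V E T} \<subseteq> card ` Pow V"
    unfolding hitting_set_def by auto
  then have "finite {card T |T. hitting_set V E T}"
    using assms(1) by (meson finite_Pow_iff finite_imageI finite_subset)
  then show ?thesis
    unfolding hitting_number_def using assms(2) by (intro Min_le) auto
qed

lemma hitting_set_closed_neighborhood: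
  assumes "finite V" "v \<in> V"
  shows "hitting_set V E (insert v (neighborhood V E v))"
  unfolding hitting_set_def
proof (intro conjI allI impI notI)
  show "insert v (neighborhood V E v) \<subseteq> V"
    using assms(2) unfolding neighborhood_def by auto
  fix I
  assume I: "max_indep V E I" and disj: "insert v (neighborhood V E v) \<inter> I = {}"
  have "I \<subseteq> V" "indep I E" and max: "\<And>J. J \<subseteq> V \<Longrightarrow> indep J E \<Longrightarrow> card J \<le> card I"
    using I unfolding max_indep_def by auto
  \<comment> \<open>An edge from \<open>v\<close> into \<open>I\<close> would put its other end into
    the neighborhood, which \<open>I\<close> avoids.\<close>
  have "indep (insert v I) E"
    using \<open>indep I E\<close> \<open>I \<subseteq> V\<close> disj unfolding indep_def neighborhood_def
    by (auto simp: insert_commute)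
  then have "card (insert v I) \<le> card I"
    using max \<open>I \<subseteq> V\<close> assms(2) by simp
  moreover have "finite I" "v \<notin> I"
    using \<open>I \<subseteq> V\<close> assms(1) disj finite_subset by auto
  ultimately show False by simp
qed

lemma hitting_number_le_simplicial:
  assumes "finite V" "simplicial \<gamma> V E v"
  shows "hitting_number V E \<le> \<gamma> * clique_number V E + 1"
proof -
  obtain C where C: "finite C" "card C \<le> \<gamma>" "\<forall>K\<in>C. clique K E" "neighborhood V E v = \<Union>C"
    and v: "v \<in> V"
    using assms(2) unfolding simplicial_def by blast
  have "\<Union>C \<subseteq> V"
    using C(4) unfolding neighborhood_def by blast
  then have "card K \<le> clique_number V E" if "K \<in> C" for K
    using that C(3) by (intro card_clique_le_clique_number[OF assms(1)]) auto
  then have "(\<Sum>K\<in>C. card K) \<le> card C * clique_number V E"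
    using sum_bounded_above[of C card] by simp
  moreover have "card (\<Union>C) \<le> (\<Sum>K\<in>C. card K)"
    using card_Union_le_sum_card by blast
  ultimately have "card (neighborhood V E v) \<le> \<gamma> * clique_number V E"
    unfolding C(4) using mult_le_mono1[OF C(2), of "clique_number V E"] by linarith
  \<comment> \<open>The extra 1 in the bound pays for \<open>v\<close> itself.\<close>
  moreover have "card (insert v (neighborhood V E v)) \<le> Suc (card (neighborhood V E v))"
    by (rule card_insert_le_m1) auto
  ultimately show ?thesis
    using hitting_number_le_card[OF assms(1) hitting_set_closed_neighborhood[OF assms(1) v, of E]]
    by linarith
qed

text \<open>If \<open>b\<close> is within 2\<rho> of \<open>a\<close>, it can serve as
  \<open>q\<close>. Otherwise walk from \<open>a\<close> towards \<open>b\<close> for a length of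
  2\<rho>: as \<open>d\<close> is at most \<rho> + \<open>s\<close>, the remaining distance
  \<open>d\<close> - 2\<rho> is at most \<open>s\<close> - \<rho>, which is the room that a ball of
  radius \<rho> needs inside \<open>cball b s\<close>.\<close>

lemma cball_contains_near_cball:
  fixes a b :: "'b::real_normed_vector"
  assumes "0 < \<rho>" "\<rho> \<le> s" "cball a \<rho> \<inter> cball b s \<noteq> {}"
  obtains q where "dist a q \<le> 2 * \<rho>" "cball q \<rho> \<subseteq> cball b s"
proof -
  define d where "d = dist a b"
  obtain z where "dist a z \<le> \<rho>" "dist b z \<le> s"
    using assms(3) by auto
  then have d: "d \<le> \<rho> + s"
    unfolding d_def using dist_triangle2[of a b z] by linarith
  show ?thesis
  proof (cases "d \<le> 2 * \<rho>")
    case True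
    then show ?thesis
      using that[of b] assms(2) unfolding d_def by (simp add: subset_cball)
  next
    case False
    define q where "q = a + (2 * \<rho> / d) *\<^sub>R (b - a)"
    have nd: "norm (b - a) = d" "0 < d"
      using False assms(1) unfolding d_def by (auto simp: dist_norm norm_minus_commute)
    have aq: "dist a q = 2 * \<rho>"
      unfolding q_def using assms(1) nd by (simp add: dist_norm)
    have "b - q = (1 - 2 * \<rho> / d) *\<^sub>R (b - a)"
      unfolding q_def by (simp add: algebra_simps)
    then have "dist b q = \<bar>1 - 2 * \<rho> / d\<bar> * d"
      using nd by (simp add: dist_norm)
    also have "\<dots> = d - 2 * \<rho>"
      using False nd by (simp add: field_simps abs_if)
    finally have "dist b q \<le> s - \<rho>"
      using d by linarith
    then have "cball q \<rho> \<subseteq> cball b s"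
      by (smt (verit) dist_triangle mem_cball subsetI)
    then show ?thesis
      using that[of q] aq by simp
  qed
qed

text \<open>One coordinate of the array of squares: three intervals of length 2\<open>h\<close>,
  centred at -2\<open>h\<close>, 0 and 2\<open>h\<close>, tile the range from -3\<open>h\<close> to
  3\<open>h\<close>.\<close>

lemma three_intervals_cover:
  fixes t h :: real
  assumes "\<bar>t\<bar> \<le> 3 * h"
  obtains k :: int where "k \<in> {-1, 0, 1}" "\<bar>t - 2 * h * k\<bar> \<le> h"
proof -
  have "\<exists>k\<in>{-1, 0, 1 :: int}. \<bar>t - 2 * h * k\<bar> \<le> h"
    using assms by (simp add: abs_le_iff) linarith
  then show ?thesis using that by blast
qed

lemma nine_discs_cover:
  fixes a :: "real ^ 2"
  assumes "0 \<le> \<rho>"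
  obtains P :: "(real ^ 2) set"
  where "finite P" "card P \<le> 9" "\<And>q. dist a q \<le> 2 * \<rho> \<Longrightarrow> \<exists>p\<in>P. dist q p \<le> \<rho>"
proof -
  \<comment> \<open>Half the side of a square whose half-diagonal is \<rho>.\<close>
  define h where "h = \<rho> * sqrt 2 / 2"
  define g :: "int \<times> int \<Rightarrow> real ^ 2"
    where "g = (\<lambda>(i, j). a + vector [2 * h * i, 2 * h * j])"
  define P where "P = g ` ({-1, 0, 1} \<times> {-1, 0, 1})"
  have h2: "2 * h\<^sup>2 = \<rho>\<^sup>2"
    unfolding h_def by (simp add: power2_eq_square)
  \<comment> \<open>Since 16/9 < 2. This is what makes three squares in a row, of total width
    6\<open>h\<close>, span the diameter 4\<rho> of the ball.\<close>
  have "4 / 3 \<le> sqrt 2"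
    by (rule real_le_rsqrt) (simp add: power2_eq_square)
  then have h3: "2 * \<rho> \<le> 3 * h"
    unfolding h_def using mult_left_mono[OF _ assms, of "4 / 3" "sqrt 2"] by simp
  have "card P \<le> card ({-1, 0, 1 :: int} \<times> {-1, 0, 1 :: int})"
    unfolding P_def by (rule card_image_le) simp
  then have "card P \<le> 9" by simp
  moreover have "\<exists>p\<in>P. dist q p \<le> \<rho>" if q: "dist a q \<le> 2 * \<rho>" for q
  proof -
    have "\<bar>(q - a) $ i\<bar> \<le> 3 * h" for i
      using component_le_norm_cart[of "q - a" i] q h3 by (simp add: dist_norm norm_minus_commute)
    note cover = three_intervals_cover[OF this]
    obtain i :: int where i: "i \<in> {-1, 0, 1}" "\<bar>(q - a) $ 1 - 2 * h * i\<bar> \<le> h"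
      using cover[of 1] .
    obtain j :: int where j: "j \<in> {-1, 0, 1}" "\<bar>(q - a) $ 2 - 2 * h * j\<bar> \<le> h"
      using cover[of 2] .
    have "q - g (i, j) = vector [(q - a) $ 1 - 2 * h * i, (q - a) $ 2 - 2 * h * j]"
      unfolding g_def by (simp add: vec_eq_iff forall_2)
    then have "(dist q (g (i, j)))\<^sup>2 = ((q - a) $ 1 - 2 * h * i)\<^sup>2 + ((q - a) $ 2 - 2 * h * j)\<^sup>2"
      by (simp add: dist_norm norm_vec_def L2_set_def sum_2)
    \<comment> \<open>Each coordinate is off by at most \<open>h\<close>, so the squared distance to
      the centre of the square is at most \<open>2 * h\<^sup>2\<close>, that is,
      \<open>\<rho>\<^sup>2\<close>.\<close>
    moreover have "((q - a) $ 1 - 2 * h * i)\<^sup>2 \<le> h\<^sup>2" "((q - a) $ 2 - 2 * h * j)\<^sup>2 \<le> h\<^sup>2"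
      using i(2) j(2) by (intro abs_le_square_iff[THEN iffD1]; linarith)+
    ultimately have "(dist q (g (i, j)))\<^sup>2 \<le> \<rho>\<^sup>2"
      using h2 by linarith
    then have "dist q (g (i, j)) \<le> \<rho>"
      using assms by (rule power2_le_imp_le)
    moreover have "g (i, j) \<in> P"
      unfolding P_def using i(1) j(1) by (intro imageI SigmaI)
    ultimately show ?thesis by (rule rev_bexI[rotated])
  qed
  ultimately show ?thesis
    using that[of P] unfolding P_def by simp
qed

lemma disk_graph_simplicial_9:
  assumes "disk_graph V E" "V \<noteq> {}"
  obtains v where "simplicial 9 V E v"
proof -
  obtain c :: "'a \<Rightarrow> real ^ 2" and r where fin: "finite V" and r: "\<forall>v\<in>V. r v > 0"
    and E: "E = {{u, v} |u v. u \<in> V \<and> v \<in> V \<and> u \<noteq> v \<and>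
                              cball (c u) (r u) \<inter> cball (c v) (r v) \<noteq> {}}"
    using assms(1) unfolding disk_graph_def by blast
  \<comment> \<open>Minimality of the radius lets \<open>cball_contains_near_cball\<close> apply to
    every neighbor of \<open>v\<close>.\<close>
  obtain v where v: "v \<in> V" "\<And>u. u \<in> V \<Longrightarrow> r v \<le> r u"
    using ex_is_arg_min_if_finite[OF fin assms(2), of r] unfolding is_arg_min_linorder by blast
  obtain P where P: "finite P" "card P \<le> 9"
      "\<And>q. dist (c v) q \<le> 2 * r v \<Longrightarrow> \<exists>p\<in>P. dist q p \<le> r v"
    using nine_discs_cover[of "r v" "c v"] r v(1) less_imp_le by metis
  have "\<exists>p\<in>P. p \<in> cball (c u) (r u)" if u: "u \<in> neighborhood V E v" for u
  proof -
    have "u \<in> V" "cball (c v) (r v) \<inter> cball (c u) (r u) \<noteq> {}"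
      using u unfolding neighborhood_def E by (auto simp: doubleton_eq_iff Int_commute)
    then obtain q where "dist (c v) q \<le> 2 * r v" "cball q (r v) \<subseteq> cball (c u) (r u)"
      using cball_contains_near_cball[of "r v" "r u" "c v" "c u"] r v by blast
    \<comment> \<open>A point of \<open>P\<close> within \<open>r v\<close> of \<open>q\<close> lies
      in the small ball around \<open>q\<close>, hence in the disk of \<open>u\<close>.\<close>
    then show ?thesis
      using P(3)[of q] by (meson mem_cball subsetD)
  qed
  \<comment> \<open>\<open>f\<close> picks a piercing point for each neighbor; neighbors with the
    same value have disks through a common point and are therefore adjacent.\<close>
  then obtain f where f: "\<And>u. u \<in> neighborhood V E v \<Longrightarrow> f u \<in> P \<and> f u \<in> cball (c u) (r u)"
    by metis
  have "simplicial 9 V E v"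
  proof (rule simplicialI_map[OF v(1) P(1,2), of f])
    fix u w
    assume uw: "u \<in> neighborhood V E v" "w \<in> neighborhood V E v" "f u = f w" "u \<noteq> w"
    then have "f u \<in> cball (c u) (r u) \<inter> cball (c w) (r w)"
      using f[of u] f[of w] by simp
    moreover have "u \<in> V" "w \<in> V"
      using uw unfolding neighborhood_def by auto
    ultimately show "{u, w} \<in> E"
      unfolding E using uw(4) by blast
  qed (use f in auto)
  then show ?thesis by (rule that)
qed

theorem theorem1p5:
  fixes V :: "'a set" and E :: "'a set set"
  assumes "disk_graph V E" and "V \<noteq> {}"
  shows "(\<exists>v\<in>V. simplicial 11 V E v) \<and> hitting_number V E \<le> 11 * clique_number V E + 1"
proof -
  obtain v where "simplicial 9 V E v"
    using disk_graph_simplicial_9[OF assms] .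
  then have v: "simplicial 11 V E v"
    by (rule simplicial_mono) simp
  then have "v \<in> V"
    unfolding simplicial_def by (rule conjunct1)
  moreover have "finite V"
    using assms(1) unfolding disk_graph_def by (rule conjunct1)
  ultimately show ?thesis
    using v hitting_number_le_simplicial[OF _ v] by auto
qed

end
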